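(* Let $G$ be the stable LTI system with coefficient matrices $(A,B,C,D)$, let $A_p\in\mathbb{R}^{n_p\times n_p}$ be Hurwitz and Metzler, let $B_p\in\mathbb{R}_+^{n_p\times n_w}$, and let $A_a,B_a,C_a,D_a$ be the augmented matrices defined in the context. Let $\gamma>0$ be given. Suppose that there exist $P_a\in\mathbb{S}^{n+n_p}$ and $Q_a\in\mathrm{COP}^{n_p+n_w}$ such that $$ \begin{bmatrix} P_aA_a + A_a^T P_a + C_a^T C_a & P_aB_a + C_a^T D_a \\ B_a^T P_a + D_a^T C_a & D_a^T D_a- \gamma ^2 I_{n_w} \end{bmatrix} + \begin{bmatrix} 0_{n,n_p+n_w} \\ I_{n_p+n_w} \end{bmatrix} Q_a \begin{bmatrix} 0_{n,n_p+n_w} \\ I_{n_p+n_w} \end{bmatrix}^T \preceq 0 . $$ Then $\|G\|_{2+}\le\gamma$.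
   Context: Notation: $\mathbb{S}^k$ is the set of $k\times k$ real symmetric matrices; $X\preceq 0$ means $X$ is negative semidefinite. $\mathbb{R}_+^{k\times l}$ is the set of entrywise nonnegative real $k\times l$ matrices. A matrix is Hurwitz if all its eigenvalues have negative real part, and Metzler if all its off-diagonal entries are nonnegative. $\mathrm{COP}^k=\{P\in\mathbb{S}^k:\ x^TPx\ge 0\ \text{for all } x\in\mathbb{R}^k \text{ with } x\ge 0 \text{ entrywise}\}$ is the copositive cone. $0_{k,l}$ is the $k\times l$ zero matrix. System: $G$ is the continuous-time LTI system $\dot x(t)=Ax(t)+Bw(t)$, $x(0)=0$, $z(t)=Cx(t)+Dw(t)$, with $A\in\mathbb{R}^{n\times n}$, $B\in\mathbb{R}^{n\times n_w}$, $C\in\mathbb{R}^{n_z\times n}$, $D\in\mathbb{R}^{n_z\times n_w}$. Standing assumptions: $A$ is Hurwitz and $(A,B)$ is controllable. Norms: for a signal $w$ on $[0,\infty)$, $\|w\|_2=\sqrt{\int_0^\infty |w(t)|_2^2\,dt}$ with $|\cdot|_2$ the Euclidean norm; $L_2=\{w:\|w\|_2<\infty\}$; $L_{2+}=\{w\in L_2:\ w(t)\ge 0 \text{ entrywise for all } t\ge 0\}$. The $L_{2+}$ induced norm is $\|G\|_{2+}=\sup_{w\in L_{2+},\ \|w\|_2=1}\|z\|_2$, where $z$ is the output of $G$ for the input $w$. Positive filter and augmented matrices: the filter is $\dot x_p=A_px_p+B_pw$, $x_p(0)=0$, with output $z_p=[x_p^T\ w^T]^T$. The augmented matrices are $$A_a=\begin{bmatrix}A&0\\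 0&A_p\end{bmatrix},\quad B_a=\begin{bmatrix}B\\ B_p\end{bmatrix},\quad C_a=\begin{bmatrix}C&0_{n_z,n_p}\end{bmatrix},\quad D_a=D.$$ *)

theory Defs
  imports "HOL-Analysis.Analysis"
begin

text \<open>Stacked vectors are indexed by sum types, so that \<open>real ^ ('n + 'm)\<close> plays the role of
  the space of dimension \<open>CARD('n) + CARD('m)\<close>.\<close>

definition vcat :: "'a ^ 'k ^ 'm \<Rightarrow> 'a ^ 'k ^ 'n \<Rightarrow> 'a ^ 'k ^ ('m::finite + 'n::finite)" where
  "vcat M N = (\<chi> i. case i of Inl r \<Rightarrow> M $ r | Inr r \<Rightarrow> N $ r)"

definition hcat :: "'a ^ 'm ^ 'k \<Rightarrow> 'a ^ 'n ^ 'k \<Rightarrow> 'a ^ ('m::finite + 'n::finite) ^ 'k" where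
  "hcat M N = (\<chi> i j. case j of Inl c \<Rightarrow> M $ i $ c | Inr c \<Rightarrow> N $ i $ c)"

definition block_matrix ::
  "'a ^ 'm ^ 'k \<Rightarrow> 'a ^ 'n ^ 'k \<Rightarrow> 'a ^ 'm ^ 'l \<Rightarrow> 'a ^ 'n ^ 'l
    \<Rightarrow> 'a ^ ('m::finite + 'n::finite) ^ ('k::finite + 'l::finite)" where
  "block_matrix M11 M12 M21 M22 = vcat (hcat M11 M12) (hcat M21 M22)"

definition symmetric_matrix :: "real ^ 'n ^ 'n \<Rightarrow> bool" where
  "symmetric_matrix P \<longleftrightarrow> transpose P = P"

definition negative_semidefinite :: "real ^ 'n ^ 'n \<Rightarrow> bool" where
  "negative_semidefinite X \<longleftrightarrow> symmetric_matrix X \<and> (\<forall>x. x \<bullet> (X *v x) \<le> 0)"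

definition COP :: "(real ^ 'n ^ 'n) set" where
  "COP = {P. symmetric_matrix P \<and> (\<forall>x. (\<forall>i. 0 \<le> x $ i) \<longrightarrow> 0 \<le> x \<bullet> (P *v x))}"

definition nonneg_matrix :: "real ^ 'n ^ 'm \<Rightarrow> bool" where
  "nonneg_matrix M \<longleftrightarrow> (\<forall>i j. 0 \<le> M $ i $ j)"

definition metzler :: "real ^ 'n ^ 'n \<Rightarrow> bool" where
  "metzler A \<longleftrightarrow> (\<forall>i j. i \<noteq> j \<longrightarrow> 0 \<le> A $ i $ j)"

definition complex_eigenvalue :: "real ^ 'n ^ 'n \<Rightarrow> complex \<Rightarrow> bool" where
  "complex_eigenvalue A \<mu> \<longleftrightarrow>
     (\<exists>v :: complex ^ 'n. v \<noteq> 0 \<and> map_matrix complex_of_real A *v v = \<mu> *s v)"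

definition hurwitz :: "real ^ 'n ^ 'n \<Rightarrow> bool" where
  "hurwitz A \<longleftrightarrow> (\<forall>\<mu>. complex_eigenvalue A \<mu> \<longrightarrow> Re \<mu> < 0)"

text \<open>Signals live on the half-line \<open>[0,\<infinity>)\<close>; their values at negative times are
  irrelevant. The norm is extended-valued, so that signals outside \<open>L2\<close> have norm \<open>\<infinity>\<close>.\<close>

definition L2_norm :: "(real \<Rightarrow> real ^ 'n) \<Rightarrow> ennreal" where
  "L2_norm w =
     (let I = \<integral>\<^sup>+t. ennreal ((norm (w t))\<^sup>2) \<partial>lebesgue_on {0..}
      in if I = \<infinity> then \<infinity> else ennreal (sqrt (enn2real I)))"

definition L2 :: "(real \<Rightarrow> real ^ 'n) set" where
  "L2 = {w. w \<in> borel_measurable (lebesgue_on {0..}) \<and> L2_norm w < \<infinity>}"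

definition L2_plus :: "(real \<Rightarrow> real ^ 'n) set" where
  "L2_plus = {w \<in> L2. \<forall>t\<ge>0. \<forall>i. 0 \<le> w t $ i}"

text \<open>Inputs in \<open>L2\<close> need not be continuous, so \<open>x' = A x + B w\<close> is understood in the
  Caratheodory sense, that is, as the corresponding integral equation.\<close>

definition state_trajectory ::
  "real ^ 'n ^ 'n \<Rightarrow> real ^ 'w ^ 'n \<Rightarrow> (real \<Rightarrow> real ^ 'w) \<Rightarrow> (real \<Rightarrow> real ^ 'n) \<Rightarrow> bool" where
  "state_trajectory A B w x \<longleftrightarrow>
     (\<forall>t\<ge>0. ((\<lambda>s. A *v x s + B *v w s) has_integral (x t - x 0)) {0..t})"

definition controllable :: "real ^ 'n ^ 'n \<Rightarrow> real ^ 'w ^ 'n \<Rightarrow> bool" where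
  "controllable A B \<longleftrightarrow>
     (\<forall>x0 x1. \<exists>T>0. \<exists>w\<in>L2. \<exists>x. state_trajectory A B w x \<and> x 0 = x0 \<and> x T = x1)"

definition system_output ::
  "real ^ 'n ^ 'n \<Rightarrow> real ^ 'w ^ 'n \<Rightarrow> real ^ 'n ^ 'z \<Rightarrow> real ^ 'w ^ 'z
    \<Rightarrow> (real \<Rightarrow> real ^ 'w) \<Rightarrow> (real \<Rightarrow> real ^ 'z) \<Rightarrow> bool" where
  "system_output A B C D w z \<longleftrightarrow>
     (\<exists>x. x 0 = 0 \<and> state_trajectory A B w x \<and> (\<forall>t\<ge>0. z t = C *v x t + D *v w t))"

text \<open>On \<open>[0,\<infinity>)\<close> the output for an input in \<open>L2\<close> exists and is unique, so ranging over pairs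
  \<open>(w, z)\<close> is the same as ranging over inputs. The supremum is taken in the extended
  nonnegative reals.\<close>

definition L2_plus_induced_norm ::
  "real ^ 'n ^ 'n \<Rightarrow> real ^ 'w ^ 'n \<Rightarrow> real ^ 'n ^ 'z \<Rightarrow> real ^ 'w ^ 'z \<Rightarrow> ennreal" where
  "L2_plus_induced_norm A B C D =
     Sup {L2_norm z | w z. w \<in> L2_plus \<and> L2_norm w = 1 \<and> system_output A B C D w z}"

definition aug_A :: "real ^ 'n ^ 'n \<Rightarrow> real ^ 'p ^ 'p \<Rightarrow> real ^ ('n + 'p) ^ ('n + 'p)" where
  "aug_A A Ap = block_matrix A 0 0 Ap"

definition aug_B :: "real ^ 'w ^ 'n \<Rightarrow> real ^ 'w ^ 'p \<Rightarrow> real ^ 'w ^ ('n + 'p)" where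
  "aug_B B Bp = vcat B Bp"

definition aug_C :: "real ^ 'n ^ 'z \<Rightarrow> real ^ ('n::finite + 'p::finite) ^ 'z" where
  "aug_C C = hcat C 0"

text \<open>The matrix with a zero block of \<open>CARD('n)\<close> rows on top of the identity of size
  \<open>CARD('p) + CARD('w)\<close>. Its rows are indexed by \<open>('n + 'p) + 'w\<close>, and not by
  \<open>'n + ('p + 'w)\<close>, to match the partition of the matrix inequality; hence the further
  subdivision into blocks.\<close>

definition zero_id :: "real ^ ('p::finite + 'w::finite) ^ (('n::finite + 'p) + 'w)" where
  "zero_id = block_matrix (vcat (0 :: real ^ 'p ^ 'n) (mat 1 :: real ^ 'p ^ 'p)) 0 0 (mat 1)"

definition dissipation_matrix ::
  "real ^ 'k ^ 'k \<Rightarrow> real ^ 'w ^ 'k \<Rightarrow> real ^ 'k ^ 'z \<Rightarrow> real ^ 'w ^ 'z \<Rightarrow> real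
    \<Rightarrow> real ^ 'k ^ 'k \<Rightarrow> real ^ ('k + 'w) ^ ('k + 'w)" where
  "dissipation_matrix A B C D \<gamma> P =
     block_matrix
       (P ** A + transpose A ** P + transpose C ** C) (P ** B + transpose C ** D)
       (transpose B ** P + transpose D ** C) (transpose D ** D - \<gamma>\<^sup>2 *\<^sub>R mat 1)"

end

theory Submission
  imports Defs "HOL-Computational_Algebra.Fundamental_Theorem_Algebra"
begin

text \<open>
  Let \<open>w\<close> be a nonnegative input of norm one, \<open>x\<close> the state that it produces, and \<open>x\<^sub>p\<close> the state
  of the filter driven by the same \<open>w\<close>. Because \<open>A\<^sub>p\<close> is Metzler and \<open>B\<^sub>p\<close> is nonnegative,
  \<open>x\<^sub>p \<ge> 0\<close>, so the copositive matrix \<open>Q\<^sub>a\<close> takes a nonnegative value at \<open>(x\<^sub>p, w)\<close>. Testing the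
  matrix inequality at \<open>(x, x\<^sub>p, w)\<close> therefore gives, for the augmented state \<open>x\<^sub>a = (x, x\<^sub>p)\<close> and
  the storage function \<open>V = x\<^sub>a\<^sup>T P\<^sub>a x\<^sub>a\<close>, the pointwise dissipation inequality
  \<open>V' + |z|\<^sup>2 \<le> \<gamma>\<^sup>2 |w|\<^sup>2\<close>, hence \<open>V(T) + \<integral>|z|\<^sup>2 \<le> \<gamma>\<^sup>2 \<integral>|w|\<^sup>2\<close> over \<open>[0,T]\<close>. Since \<open>P\<^sub>a\<close> may be
  indefinite, \<open>V(T)\<close> cannot simply be dropped; but \<open>A\<close> and \<open>A\<^sub>p\<close> are Hurwitz, so \<open>x\<^sub>a\<close> is square
  integrable and \<open>V(T)\<close> is arbitrarily small at suitable arbitrarily late times \<open>T\<close>.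

  Three facts carry the argument.

  The first is calculus for states that are merely absolutely continuous: a product rule for
  indefinite integrals (\<open>ac_deriv_bilinear\<close>). It rests on the uniform continuity of both factors:
  over a fine partition, freezing one factor at an endpoint costs arbitrarily little.

  The second is that a Hurwitz system maps square integrable inputs to square integrable states
  (\<open>hurwitz_imp_square_integrable\<close>). Some product \<open>(A - \<lambda>\<^sub>1)\<cdots>(A - \<lambda>\<^sub>m)\<close> over eigenvalues
  vanishes. Put \<open>y\<^sub>k = (A - \<lambda>\<^sub>1)\<cdots>(A - \<lambda>\<^sub>k) x\<close>; then \<open>y\<^sub>m = 0\<close>, and
  \<open>y\<^sub>k' = \<lambda>\<^bsub>k+1\<^esub> y\<^sub>k + y\<^bsub>k+1\<^esub> +\<close> a square integrable term. As \<open>Re \<lambda>\<^bsub>k+1\<^esub> < 0\<close>, an energy estimate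
  passes square integrability from \<open>y\<^bsub>k+1\<^esub>\<close> down to \<open>y\<^sub>k\<close>, and finally to \<open>y\<^sub>0 = x\<close>.

  The third is existence and nonnegativity of the filter state (\<open>metzler_positive_system\<close>).
  With \<open>N = A\<^sub>p + c I \<ge> 0\<close>, the function \<open>exp(c t) x\<^sub>p\<close> solves an equation whose Picard series has
  nonnegative terms only.
\<close>

section \<open>Absolutely continuous functions on the half-line\<close>

text \<open>Local absolute continuity on \<open>[0,\<infinity>)\<close>, expressed by the density \<open>g\<close> rather than by
  differentiability almost everywhere: this is the form in which Caratheodory solutions are given.
  Absolute integrability of \<open>g\<close> makes products with continuous functions integrable.\<close>

definition ac_deriv :: "(real \<Rightarrow> 'a::euclidean_space) \<Rightarrow> (real \<Rightarrow> 'a) \<Rightarrow> bool" where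
  "ac_deriv x g \<longleftrightarrow>
     (\<forall>T\<ge>0. g absolutely_integrable_on {0..T} \<and> (g has_integral x T - x 0) {0..T})"

lemma ac_deriv_abs_integrable:
  assumes "ac_deriv x g" "0 \<le> a"
  shows "g absolutely_integrable_on {a..b}"
proof (cases "a \<le> b")
  case True
  with assms have "g absolutely_integrable_on {0..b}" by (auto simp: ac_deriv_def)
  then show ?thesis by (rule absolutely_integrable_on_subinterval) (use assms in auto)
qed auto

lemma ac_deriv_increment:
  assumes "ac_deriv x g" "0 \<le> a" "a \<le> b"
  shows "(g has_integral x b - x a) {a..b}"
proof -
  have a: "(g has_integral x a - x 0) {0..a}" and b: "(g has_integral x b - x 0) {0..b}"
    using assms by (auto simp: ac_deriv_def)
  have g: "g integrable_on {a..b}"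
    using ac_deriv_abs_integrable[OF assms(1,2)] set_lebesgue_integral_eq_integral(1) by blast
  have "integral {0..a} g + integral {a..b} g = integral {0..b} g"
    using assms has_integral_integrable[OF b] by (intro Henstock_Kurzweil_Integration.integral_combine) auto
  then have "integral {a..b} g = x b - x a"
    using a b by (simp add: integral_unique algebra_simps)
  then show ?thesis using g by (metis integrable_integral)
qed

lemma ac_deriv_continuous:
  assumes "ac_deriv x g"
  shows "continuous_on {0..T} x"
proof -
  have "continuous_on {0..T} (\<lambda>t. x 0 + integral {0..t} g)"
    using ac_deriv_abs_integrable[OF assms order_refl, of T]
    by (intro continuous_intros indefinite_integral_continuous_1)
       (auto simp: set_lebesgue_integral_eq_integral)
  moreover have "x 0 + integral {0..t} g = x t" if "t \<in> {0..T}" for t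
    using ac_deriv_increment[OF assms order_refl, of t] that by (simp add: integral_unique)
  ultimately show ?thesis by (rule continuous_on_eq)
qed

lemma ac_deriv_linear:
  assumes "ac_deriv x g" "linear h"
  shows "ac_deriv (\<lambda>t. h (x t)) (\<lambda>t. h (g t))"
proof -
  have h: "bounded_linear h" using assms(2) by (simp add: linear_conv_bounded_linear)
  show ?thesis
    using assms absolutely_integrable_linear[OF _ h, where f = g] has_integral_linear[OF _ h, where f = g]
    by (force simp: ac_deriv_def o_def simp flip: linear_diff[OF assms(2)])
qed

lemma ac_deriv_add:
  assumes "ac_deriv x f" "ac_deriv y g"
  shows "ac_deriv (\<lambda>t. x t + y t) (\<lambda>t. f t + g t)"
  unfolding ac_deriv_def
proof (intro allI impI conjI)
  fix T :: real assume T: "0 \<le> T"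
  show "(\<lambda>t. f t + g t) absolutely_integrable_on {0..T}"
    using assms T by (intro set_integral_add) (auto simp: ac_deriv_def)
  have "((\<lambda>t. f t + g t) has_integral (x T - x 0) + (y T - y 0)) {0..T}"
    using assms T by (intro has_integral_add) (auto simp: ac_deriv_def)
  then show "((\<lambda>t. f t + g t) has_integral x T + y T - (x 0 + y 0)) {0..T}"
    by (simp add: algebra_simps)
qed

lemma abs_integrable_continuous_product:
  fixes u :: "real \<Rightarrow> 'a::euclidean_space" and g :: "real \<Rightarrow> 'b::euclidean_space"
    and h :: "'a \<Rightarrow> 'b \<Rightarrow> 'c::euclidean_space"
  assumes "bounded_bilinear h" "continuous_on {a..b} u" "g absolutely_integrable_on {a..b}"
  shows "(\<lambda>t. h (u t) (g t)) absolutely_integrable_on {a..b}"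
proof (rule absolutely_integrable_bounded_measurable_product[where h = h])
  show "bilinear h" using assms(1) by (simp add: bilinear_conv_bounded_bilinear)
  show "u \<in> borel_measurable (lebesgue_on {a..b})"
    using assms(2) by (intro continuous_imp_measurable_on_sets_lebesgue) auto
  show "bounded (u ` {a..b})"
    using assms(2) by (intro compact_imp_bounded compact_continuous_image) auto
qed (use assms(3) in auto)

text \<open>The analogue of "zero derivative implies constant": if the increments of \<open>F\<close> over short
  intervals are \<open>o(1)\<close> times those of some fixed \<open>G\<close>, then summing over a fine partition of \<open>[0,T]\<close>
  bounds the total increment by \<open>o(1) (G T - G 0)\<close>.\<close>

lemma zero_increment_if_small_variation:
  fixes F :: "real \<Rightarrow> 'a::real_normed_vector" and G :: "real \<Rightarrow> real"
  assumes T: "0 \<le> T"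
    and small: "\<And>e. e > 0 \<Longrightarrow> \<exists>d>0. \<forall>a b. 0 \<le> a \<and> a \<le> b \<and> b \<le> T \<and> b - a < d
                 \<longrightarrow> norm (F b - F a) \<le> e * (G b - G a)"
  shows "F T = F 0"
proof -
  have le: "norm (F T - F 0) \<le> e * (G T - G 0)" if e: "e > 0" for e
  proof -
    obtain d where d: "d > 0" and *: "\<And>a b. 0 \<le> a \<Longrightarrow> a \<le> b \<Longrightarrow> b \<le> T \<Longrightarrow> b - a < d
                 \<Longrightarrow> norm (F b - F a) \<le> e * (G b - G a)"
      using small[OF e] by blast
    obtain n :: nat where n: "T / d < real n" using reals_Archimedean2 by blast
    then have n0: "0 < n" using T d by (metis divide_nonneg_pos less_le_trans not_le of_nat_0_less_iff)
    \<comment> \<open>the uniform partition into \<open>n\<close> intervals shorter than \<open>d\<close>\<close>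
    define p where "p i = real i * (T / n)" for i
    have step: "norm (F (p (Suc i)) - F (p i)) \<le> e * (G (p (Suc i)) - G (p i))" if i: "i < n" for i
    proof (rule *)
      show "0 \<le> p i" "p i \<le> p (Suc i)" using T by (auto simp: p_def algebra_simps divide_right_mono)
      have "real (Suc i) * (T / n) \<le> n * (T / n)" using i T by (intro mult_right_mono) auto
      then show "p (Suc i) \<le> T" using n0 by (simp add: p_def)
      have "p (Suc i) - p i = T / n" by (simp add: p_def algebra_simps add_divide_distrib)
      also have "\<dots> < d" using n d n0 by (simp add: field_simps)
      finally show "p (Suc i) - p i < d" .
    qed
    have ends: "p n = T" "p 0 = 0" using n0 by (auto simp: p_def)
    have "norm (F T - F 0) = norm (\<Sum>i<n. F (p (Suc i)) - F (p i))"
      using sum_lessThan_telescope[of "\<lambda>i. F (p i)" n] ends by simp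
    also have "\<dots> \<le> (\<Sum>i<n. e * (G (p (Suc i)) - G (p i)))"
      using step by (intro sum_norm_le) auto
    also have "\<dots> = e * (G T - G 0)"
      using sum_lessThan_telescope[of "\<lambda>i. G (p i)" n] ends by (simp flip: sum_distrib_left)
    finally show ?thesis .
  qed
  have "norm (F T - F 0) \<le> 0"
  proof (rule field_le_epsilon)
    fix e :: real assume e: "e > 0"
    have "norm (F T - F 0) \<le> e / (1 + \<bar>G T - G 0\<bar>) * (G T - G 0)" using e by (intro le) auto
    also have "\<dots> \<le> e / (1 + \<bar>G T - G 0\<bar>) * (1 + \<bar>G T - G 0\<bar>)" using e by (intro mult_left_mono) auto
    also have "\<dots> = 0 + e" by (simp add: add_nonneg_eq_0_iff)
    finally show "norm (F T - F 0) \<le> 0 + e" .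
  qed
  then show ?thesis by simp
qed

text \<open>Over a short interval \<open>[a,b]\<close>, the increment of \<open>h u v\<close> is exactly the integral of
  \<open>h (u' s) (v b) + h (u a) (v' s)\<close>. Replacing \<open>v b\<close> by \<open>v s\<close> and \<open>u a\<close> by \<open>u s\<close> costs at most \<open>e\<close> times
  the integral of \<open>|u'| + |v'|\<close>, by uniform continuity; so the difference between \<open>h u v\<close> and the
  integral of its expected derivative has negligible variation.\<close>

lemma ac_deriv_bilinear:
  fixes h :: "'a::euclidean_space \<Rightarrow> 'b::euclidean_space \<Rightarrow> 'c::euclidean_space"
  assumes h: "bounded_bilinear h" and u: "ac_deriv u u'" and v: "ac_deriv v v'"
  shows "ac_deriv (\<lambda>t. h (u t) (v t)) (\<lambda>t. h (u' t) (v t) + h (u t) (v' t))"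
proof -
  interpret h: bounded_bilinear h by fact
  define w where "w t = h (u' t) (v t) + h (u t) (v' t)" for t
  have w_abs: "w absolutely_integrable_on {0..T}" for T
    unfolding w_def
    using abs_integrable_continuous_product[OF h
        ac_deriv_continuous[OF u] ac_deriv_abs_integrable[OF v order_refl], of T]
      abs_integrable_continuous_product[OF h.flip
        ac_deriv_continuous[OF v] ac_deriv_abs_integrable[OF u order_refl], of T]
    by (intro set_integral_add) auto
  then have w_int: "w integrable_on {a..b}" if "0 \<le> a" for a b
    using absolutely_integrable_on_subinterval[OF w_abs[of b], of a b] that set_lebesgue_integral_eq_integral(1)
    by (cases "a \<le> b") fastforce+
  define g where "g t = norm (u' t) + norm (v' t)" for t
  have g_int: "g integrable_on {a..b}" if "0 \<le> a" for a b
    unfolding g_def using ac_deriv_abs_integrable[OF u that, of b] ac_deriv_abs_integrable[OF v that, of b]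
    by (intro integrable_add) (auto simp: absolutely_integrable_on_def)
  \<comment> \<open>the claim is that \<open>F\<close> is constant; \<open>G\<close> controls its variation\<close>
  define F where "F t = h (u t) (v t) - integral {0..t} w" for t
  define G where "G t = integral {0..t} g" for t
  have F_const: "F T = F 0" if T: "0 \<le> T" for T
  proof (rule zero_increment_if_small_variation[OF T, where G = G])
    fix e :: real assume e: "e > 0"
    obtain K where K: "K > 0" and hK: "\<And>a b. norm (h a b) \<le> norm a * norm b * K"
      using h.pos_bounded by blast
    have "uniformly_continuous_on {0..T} u" "uniformly_continuous_on {0..T} v"
      using ac_deriv_continuous[OF u] ac_deriv_continuous[OF v] by (auto intro: compact_uniformly_continuous)
    moreover have eK: "e / K > 0" using e K by simp
    ultimately obtain d1 d2 where d: "d1 > 0" "d2 > 0"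
      and d1: "\<And>s t. s \<in> {0..T} \<Longrightarrow> t \<in> {0..T} \<Longrightarrow> dist s t < d1 \<Longrightarrow> dist (u s) (u t) < e / K"
      and d2: "\<And>s t. s \<in> {0..T} \<Longrightarrow> t \<in> {0..T} \<Longrightarrow> dist s t < d2 \<Longrightarrow> dist (v s) (v t) < e / K"
      unfolding uniformly_continuous_on_def by metis
    have "norm (F b - F a) \<le> e * (G b - G a)" if ab: "0 \<le> a" "a \<le> b" "b \<le> T" "b - a < min d1 d2" for a b
    proof -
      have "((\<lambda>s. h (u' s) (v b)) has_integral h (u b - u a) (v b)) {a..b}"
        using has_integral_linear[OF ac_deriv_increment[OF u ab(1,2)] h.bounded_linear_left[of "v b"]]
        by (simp add: o_def)
      moreover have "((\<lambda>s. h (u a) (v' s)) has_integral h (u a) (v b - v a)) {a..b}"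
        using has_integral_linear[OF ac_deriv_increment[OF v ab(1,2)] h.bounded_linear_right[of "u a"]]
        by (simp add: o_def)
      moreover have "(w has_integral integral {0..b} w - integral {0..a} w) {a..b}"
        using Henstock_Kurzweil_Integration.integral_combine[of 0 a b w] ab w_int[of 0 b] w_int[of a b]
        by (simp add: has_integral_iff algebra_simps)
      ultimately have "((\<lambda>s. h (u' s) (v b) + h (u a) (v' s) - w s) has_integral
         (h (u b - u a) (v b) + h (u a) (v b - v a) - (integral {0..b} w - integral {0..a} w))) {a..b}"
        by (intro has_integral_diff has_integral_add)
      also have "h (u b - u a) (v b) + h (u a) (v b - v a) - (integral {0..b} w - integral {0..a} w) = F b - F a"
        by (simp add: F_def h.diff_left h.diff_right)
      finally have int: "((\<lambda>s. h (u' s) (v b) + h (u a) (v' s) - w s) has_integral (F b - F a)) {a..b}" .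
      have bound: "norm (h (u' s) (v b) + h (u a) (v' s) - w s) \<le> e * g s" if s: "s \<in> {a..b}" for s
      proof -
        have "dist (u a) (u s) < e / K" "dist (v b) (v s) < e / K"
          using s ab by (intro d1 d2; simp add: dist_real_def)+
        then have close: "norm (u a - u s) * K \<le> e" "norm (v b - v s) * K \<le> e"
          using K by (auto simp: dist_norm field_simps)
        have "h (u' s) (v b) + h (u a) (v' s) - w s = h (u' s) (v b - v s) + h (u a - u s) (v' s)"
          by (simp add: w_def h.diff_left h.diff_right)
        also have "norm \<dots> \<le> norm (u' s) * norm (v b - v s) * K + norm (u a - u s) * norm (v' s) * K"
          by (intro norm_triangle_le add_mono hK)
        also have "\<dots> = norm (u' s) * (norm (v b - v s) * K) + norm (v' s) * (norm (u a - u s) * K)"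
          by (simp add: mult_ac)
        also have "\<dots> \<le> norm (u' s) * e + norm (v' s) * e"
          by (intro add_mono mult_left_mono close) auto
        finally show ?thesis by (simp add: g_def algebra_simps)
      qed
      have "norm (F b - F a) \<le> integral {a..b} (\<lambda>s. e * g s)"
        unfolding integral_unique[OF int, symmetric]
        using int integrable_cmul[OF g_int[OF ab(1), of b], of e] bound
        by (intro Henstock_Kurzweil_Integration.integral_norm_bound_integral) auto
      also have "\<dots> = e * (G b - G a)"
      proof -
        have "integral {a..b} g = G b - G a"
          using Henstock_Kurzweil_Integration.integral_combine[of 0 a b g] ab g_int[of 0 b]
          by (simp add: G_def)
        then show ?thesis by simp
      qed
      finally show ?thesis .
    qed
    then show "\<exists>d>0. \<forall>a b. 0 \<le> a \<and> a \<le> b \<and> b \<le> T \<and> b - a < d \<longrightarrow> norm (F b - F a) \<le> e * (G b - G a)"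
      using d by (intro exI[of _ "min d1 d2"]) auto
  qed
  have "(w has_integral h (u T) (v T) - h (u 0) (v 0)) {0..T}" if "0 \<le> T" for T
    using F_const[OF that] w_int[of 0 T] by (simp add: F_def has_integral_iff algebra_simps)
  then show ?thesis
    using w_abs unfolding ac_deriv_def w_def by blast
qed

text \<open>The integral equation alone makes \<open>x\<close> continuous, and continuity makes \<open>A x\<close> absolutely
  integrable on bounded intervals.\<close>

lemma state_trajectory_imp_ac_deriv:
  assumes "state_trajectory A B w x"
    and w: "\<And>T. w absolutely_integrable_on {0..T}"
  shows "ac_deriv x (\<lambda>t. A *v x t + B *v w t)"
proof -
  define g where "g t = A *v x t + B *v w t" for t
  have g: "(g has_integral x T - x 0) {0..T}" if "0 \<le> T" for T
    using assms(1) that unfolding state_trajectory_def g_def by blast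
  have "g absolutely_integrable_on {0..T}" if T: "0 \<le> T" for T
  proof -
    have "continuous_on {0..T} (\<lambda>t. x 0 + integral {0..t} g)"
      using g[OF T] by (intro continuous_intros indefinite_integral_continuous_1) auto
    then have "continuous_on {0..T} x"
      by (rule continuous_on_eq) (use integral_unique[OF g] in simp)
    then have "continuous_on {0..T} (\<lambda>t. A *v x t)"
      by (rule bounded_linear.continuous_on[OF matrix_vector_mul_bounded_linear])
    then have "(\<lambda>t. A *v x t) absolutely_integrable_on {0..T}"
      by (rule absolutely_integrable_continuous_real)
    then show ?thesis
      unfolding g_def using absolutely_integrable_linear[OF w[of T] matrix_vector_mul_bounded_linear[of B]]
      by (intro set_integral_add) (auto simp: o_def)
  qed
  with g show ?thesis by (simp add: ac_deriv_def flip: g_def)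
qed

section \<open>Square integrable signals\<close>

text \<open>Membership in \<open>L2\<close> for arbitrary Euclidean values, stated with the gauge integral so
  that it combines with the integral equations for states.\<close>

definition square_integrable :: "(real \<Rightarrow> 'a::euclidean_space) \<Rightarrow> bool" where
  "square_integrable f \<longleftrightarrow>
     f \<in> borel_measurable (lebesgue_on {0..}) \<and> (\<lambda>t. (norm (f t))\<^sup>2) integrable_on {0..}"

lemma nonneg_integrable_on_halfline:
  fixes g :: "real \<Rightarrow> real"
  assumes nonneg: "\<And>t. 0 \<le> t \<Longrightarrow> 0 \<le> g t" and int: "\<And>T. 0 \<le> T \<Longrightarrow> g integrable_on {0..T}"
    and le: "\<And>T. 0 \<le> T \<Longrightarrow> integral {0..T} g \<le> M"
  shows "g integrable_on {0..}" "integral {0..} g \<le> M"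
proof -
  define f where "f k t = (if t \<in> {0..real k} then g t else 0)" for k t
  have f_int: "f k integrable_on {0..}" for k
    unfolding f_def using int[of "real k"]
    by (subst integrable_restrict_Int) (simp add: Int_absorb2 atLeastAtMost_def)
  have f_eq: "integral {0..} (f k) = integral {0..real k} g" for k
    unfolding f_def by (subst integral_restrict_Int) (simp add: Int_absorb2 atLeastAtMost_def)
  have "0 \<le> integral {0..real k} g" for k using int nonneg by (intro integral_nonneg) auto
  then have "\<bar>integral {0..} (f k)\<bar> \<le> M" for k using le[of "real k"] f_eq[of k] by simp
  then have bounded: "bounded (range (\<lambda>k. integral {0..} (f k)))"
    unfolding bounded_iff by auto
  have lim: "(\<lambda>k. f k t) \<longlonglongrightarrow> g t" if "t \<in> {0..}" for t
  proof (rule tendsto_eventually)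
    obtain n where "t \<le> real n" using real_arch_simple by blast
    then show "\<forall>\<^sub>F k in sequentially. f k t = g t"
      using that by (intro eventually_sequentiallyI[of n]) (auto simp: f_def)
  qed
  have "g integrable_on {0..} \<and> (\<lambda>k. integral {0..} (f k)) \<longlonglongrightarrow> integral {0..} g"
    using f_int bounded lim nonneg
    by (intro monotone_convergence_increasing) (auto simp: f_def)
  then show "g integrable_on {0..}" "integral {0..} g \<le> M"
    using le f_eq by (auto intro!: LIMSEQ_le_const2)
qed

lemma square_integrable_norm_square:
  assumes "square_integrable f" "0 \<le> a"
  shows "(\<lambda>t. (norm (f t))\<^sup>2) integrable_on {a..b}"
proof (cases "a \<le> b")
  case True
  have "(\<lambda>t. (norm (f t))\<^sup>2) absolutely_integrable_on {0..}"
    using assms by (intro nonnegative_absolutely_integrable_1) (auto simp: square_integrable_def)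
  then have "(\<lambda>t. (norm (f t))\<^sup>2) absolutely_integrable_on {a..b}"
    by (rule absolutely_integrable_on_subinterval) (use assms in auto)
  then show ?thesis by (rule set_lebesgue_integral_eq_integral(1))
qed auto

lemma square_integrable_integral_le:
  assumes "square_integrable f"
  shows "integral {0..T} (\<lambda>t. (norm (f t))\<^sup>2) \<le> integral {0..} (\<lambda>t. (norm (f t))\<^sup>2)"
  using assms square_integrable_norm_square[OF assms order_refl]
  by (intro integral_subset_le) (auto simp: square_integrable_def)

lemma square_integrable_abs_integrable:
  fixes f :: "real \<Rightarrow> 'a::euclidean_space"
  assumes "square_integrable f"
  shows "f absolutely_integrable_on {0..T}"
proof (rule measurable_bounded_by_integrable_imp_absolutely_integrable)
  show "f \<in> borel_measurable (lebesgue_on {0..T})"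
    using assms by (auto simp: square_integrable_def intro: measurable_restrict_mono)
  show "(\<lambda>t. 1 + (norm (f t))\<^sup>2) integrable_on {0..T}"
    using square_integrable_norm_square[OF assms order_refl] by (intro integrable_add) auto
  show "norm (f t) \<le> 1 + (norm (f t))\<^sup>2" for t
    using zero_le_power2[of "norm (f t) - 1"] by (simp add: power2_diff)
      (smt (verit) norm_ge_zero)
qed auto

lemma square_integrable_bound:
  fixes f :: "real \<Rightarrow> 'a::euclidean_space"
  assumes f: "f \<in> borel_measurable (lebesgue_on {0..})" and g: "g integrable_on {0..}"
    and le: "\<And>t. 0 \<le> t \<Longrightarrow> (norm (f t))\<^sup>2 \<le> g t"
  shows "square_integrable f"
proof -
  have "(\<lambda>t. (norm (f t))\<^sup>2) absolutely_integrable_on {0..}"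
    using f le by (intro measurable_bounded_by_integrable_imp_absolutely_integrable[OF _ _ g]) auto
  then show ?thesis
    using f by (auto simp: square_integrable_def set_lebesgue_integral_eq_integral)
qed

lemma square_integrable_add:
  fixes f g :: "real \<Rightarrow> 'a::euclidean_space"
  assumes "square_integrable f" "square_integrable g"
  shows "square_integrable (\<lambda>t. f t + g t)"
proof (rule square_integrable_bound)
  show "(\<lambda>t. 2 * (norm (f t))\<^sup>2 + 2 * (norm (g t))\<^sup>2) integrable_on {0..}"
    using assms by (intro integrable_add integrable_on_mult_right) (auto simp: square_integrable_def)
  show "(norm (f t + g t))\<^sup>2 \<le> 2 * (norm (f t))\<^sup>2 + 2 * (norm (g t))\<^sup>2" for t
  proof -
    have "(norm (f t + g t))\<^sup>2 \<le> (norm (f t) + norm (g t))\<^sup>2"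
      by (intro power_mono norm_triangle_ineq) auto
    also have "\<dots> \<le> 2 * (norm (f t))\<^sup>2 + 2 * (norm (g t))\<^sup>2"
      using zero_le_power2[of "norm (f t) - norm (g t)"] by (simp add: power2_diff power2_sum)
    finally show ?thesis .
  qed
qed (use assms in \<open>auto simp: square_integrable_def\<close>)

lemma square_integrable_linear:
  fixes f :: "real \<Rightarrow> 'a::euclidean_space" and h :: "'a \<Rightarrow> 'b::euclidean_space"
  assumes "square_integrable f" "linear h"
  shows "square_integrable (\<lambda>t. h (f t))"
proof -
  have h: "bounded_linear h" using assms(2) by (simp add: linear_conv_bounded_linear)
  obtain K where K: "\<And>x. norm (h x) \<le> norm x * K" using bounded_linear.bounded[OF h] by blast
  show ?thesis
  proof (rule square_integrable_bound)
    have "h \<in> borel_measurable borel"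
      using h by (intro borel_measurable_continuous_onI linear_continuous_on)
    then show "(\<lambda>t. h (f t)) \<in> borel_measurable (lebesgue_on {0..})"
      using assms(1) by (auto simp: square_integrable_def)
    show "(\<lambda>t. K\<^sup>2 * (norm (f t))\<^sup>2) integrable_on {0..}"
      using assms by (intro integrable_on_mult_right) (auto simp: square_integrable_def)
    show "(norm (h (f t)))\<^sup>2 \<le> K\<^sup>2 * (norm (f t))\<^sup>2" for t
      using power_mono[OF K norm_ge_zero, of "f t" 2] by (simp add: power_mult_distrib mult.commute)
  qed
qed

text \<open>Otherwise the squared norm would stay above \<open>e\<close> on \<open>[S,\<infinity>)\<close> and have infinite integral.\<close>

lemma square_integrable_frequently_small:
  assumes f: "square_integrable f" and e: "e > 0" and S: "0 \<le> S"
  obtains T where "T \<ge> S" "(norm (f T))\<^sup>2 < e"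
proof -
  define I where "I = integral {0..} (\<lambda>t. (norm (f t))\<^sup>2)"
  obtain n :: nat where n: "I < real n * e" using e reals_Archimedean3 by blast
  have "\<exists>T\<ge>S. (norm (f T))\<^sup>2 < e"
  proof (rule ccontr)
    assume "\<not> ?thesis"
    then have ge: "e \<le> (norm (f T))\<^sup>2" if "S \<le> T" for T using that by force
    have "real n * e = integral {S..S + n} (\<lambda>_. e)" by simp
    also have "\<dots> \<le> integral {S..S + n} (\<lambda>t. (norm (f t))\<^sup>2)"
      using ge square_integrable_norm_square[OF f S] by (intro integral_le) auto
    also have "\<dots> \<le> I"
      unfolding I_def using f S square_integrable_norm_square[OF f S]
      by (intro integral_subset_le) (auto simp: square_integrable_def)
    finally show False using n by simp
  qed
  then show ?thesis using that by blast
qed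

lemma nn_integral_norm_square:
  assumes "square_integrable f"
  shows "(\<integral>\<^sup>+t. ennreal ((norm (f t))\<^sup>2) \<partial>lebesgue_on {0..}) = ennreal (integral {0..} (\<lambda>t. (norm (f t))\<^sup>2))"
proof -
  have "((\<lambda>t. (norm (f t))\<^sup>2) has_integral integral {0..} (\<lambda>t. (norm (f t))\<^sup>2)) {0..}"
    using assms by (auto simp: square_integrable_def)
  then show ?thesis
    by (simp add: nn_integral_restrict_space nn_integral_completion nn_integral_has_integral_lebesgue')
qed

lemma L2_norm_square_integrable:
  assumes "square_integrable f"
  shows "L2_norm f = ennreal (sqrt (integral {0..} (\<lambda>t. (norm (f t))\<^sup>2)))"
  using assms integral_nonneg[of "\<lambda>t. (norm (f t))\<^sup>2" "{0..}"]
  by (simp add: L2_norm_def nn_integral_norm_square square_integrable_def)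

lemma L2_imp_square_integrable:
  assumes "w \<in> L2"
  shows "square_integrable w"
proof -
  have w: "w \<in> borel_measurable (lebesgue_on {0..})" using assms by (simp add: L2_def)
  have "(\<integral>\<^sup>+t. ennreal ((norm (w t))\<^sup>2) \<partial>lebesgue_on {0..}) < \<infinity>"
    using assms by (auto simp: L2_def L2_norm_def Let_def less_top split: if_splits)
  then have "integrable (lebesgue_on {0..}) (\<lambda>t. (norm (w t))\<^sup>2)"
    using w by (intro integrableI_nonneg) auto
  then show ?thesis using w by (simp add: square_integrable_def integrable_on_lebesgue_on)
qed

lemma square_integrable_cong:
  assumes "square_integrable f" "\<And>t. 0 \<le> t \<Longrightarrow> f t = g t"
  shows "square_integrable g"
proof -
  have "g \<in> borel_measurable (lebesgue_on {0..})"
    using assms by (subst measurable_cong[where g = f]) (auto simp: square_integrable_def)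
  then show ?thesis
    using assms by (intro square_integrable_bound[where g = "\<lambda>t. (norm (f t))\<^sup>2"]) (auto simp: square_integrable_def)
qed

section \<open>Stable systems map square integrable inputs to square integrable states\<close>

lemma ac_deriv_continuous_halfline:
  assumes "ac_deriv x g"
  shows "continuous_on {0..} x"
  unfolding continuous_on_eq_continuous_within
proof
  fix t :: real assume t: "t \<in> {0..}"
  have "at t within {0..} = at t within {0..t+1}"
    using t by (intro at_within_nhd[where S = "{..<t+1}"]) auto
  moreover have "continuous (at t within {0..t+1}) x"
    using ac_deriv_continuous[OF assms, of "t+1"] t by (auto simp: continuous_on_eq_continuous_within)
  ultimately show "continuous (at t within {0..}) x" by (simp add: continuous_within)
qed

text \<open>The energy estimate: \<open>(|y|\<^sup>2)' = 2 y \<bullet> (K y + f) \<le> - 2 a |y|\<^sup>2 + 2 |y| |f|\<close>, and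
  \<open>2 |y| |f| \<le> a |y|\<^sup>2 + |f|\<^sup>2 / a\<close>. Integrating bounds \<open>a \<integral>|y|\<^sup>2\<close> by \<open>|y 0|\<^sup>2 + (1/a) \<integral>|f|\<^sup>2\<close>,
  uniformly in the length of the interval.\<close>

lemma dissipative_imp_square_integrable:
  fixes y f :: "real \<Rightarrow> 'a::euclidean_space" and K :: "'a \<Rightarrow> 'a"
  assumes y: "ac_deriv y (\<lambda>t. K (y t) + f t)" and f: "square_integrable f"
    and a: "a > 0" and K: "\<And>v. v \<bullet> K v \<le> - a * (norm v)\<^sup>2"
  shows "square_integrable y"
proof -
  define E' where "E' t = 2 * (y t \<bullet> (K (y t) + f t))" for t
  have "ac_deriv (\<lambda>t. y t \<bullet> y t) E'"
    unfolding E'_def using ac_deriv_bilinear[OF bounded_bilinear_inner y y] by (simp add: inner_commute)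
  then have E': "(E' has_integral (norm (y T))\<^sup>2 - (norm (y 0))\<^sup>2) {0..T}" if "0 \<le> T" for T
    using that by (simp add: ac_deriv_def power2_norm_eq_inner)
  have y_int: "(\<lambda>t. (norm (y t))\<^sup>2) integrable_on {0..T}" for T
    by (intro integrable_continuous_real continuous_intros ac_deriv_continuous[OF y])
  have E'_le: "E' t \<le> (1/a) * (norm (f t))\<^sup>2 - a * (norm (y t))\<^sup>2" for t
  proof -
    have "2 * (y t \<bullet> f t) \<le> 2 * (norm (y t) * norm (f t))" by (simp add: norm_cauchy_schwarz)
    also have "\<dots> \<le> a * (norm (y t))\<^sup>2 + (1/a) * (norm (f t))\<^sup>2"
      using a zero_le_power2[of "a * norm (y t) - norm (f t)"]
      by (simp add: field_simps power2_eq_square)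
    finally show ?thesis using K[of "y t"] by (simp add: E'_def inner_add_right)
  qed
  define M where "M = (norm (y 0))\<^sup>2 + (1/a) * integral {0..} (\<lambda>t. (norm (f t))\<^sup>2)"
  have bound: "integral {0..T} (\<lambda>t. (norm (y t))\<^sup>2) \<le> M / a" if T: "0 \<le> T" for T
  proof -
    note f_int = square_integrable_norm_square[OF f order_refl, of T]
    have "(norm (y T))\<^sup>2 - (norm (y 0))\<^sup>2
        \<le> integral {0..T} (\<lambda>t. (1/a) * (norm (f t))\<^sup>2 - a * (norm (y t))\<^sup>2)"
      unfolding integral_unique[OF E'[OF T], symmetric]
      using E'[OF T] E'_le y_int f_int
      by (intro integral_le integrable_diff integrable_on_mult_right) auto
    also have "\<dots> = (1/a) * integral {0..T} (\<lambda>t. (norm (f t))\<^sup>2)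
        - a * integral {0..T} (\<lambda>t. (norm (y t))\<^sup>2)"
      using y_int f_int
      by (subst integral_diff) (auto simp del: times_divide_eq_left intro!: integrable_on_mult_right)
    also have "\<dots> \<le> (1/a) * integral {0..} (\<lambda>t. (norm (f t))\<^sup>2)
        - a * integral {0..T} (\<lambda>t. (norm (y t))\<^sup>2)"
      using square_integrable_integral_le[OF f] a by (intro diff_right_mono mult_left_mono) auto
    finally have "a * integral {0..T} (\<lambda>t. (norm (y t))\<^sup>2) \<le> M"
      using zero_le_power2[of "norm (y T)"] unfolding M_def by linarith
    then show ?thesis using a by (simp add: field_simps)
  qed
  have "(\<lambda>t. (norm (y t))\<^sup>2) integrable_on {0..}"
    by (rule nonneg_integrable_on_halfline[OF _ y_int bound]) auto
  moreover have "y \<in> borel_measurable (lebesgue_on {0..})"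
    using ac_deriv_continuous_halfline[OF y] by (intro continuous_imp_measurable_on_sets_lebesgue) auto
  ultimately show ?thesis by (simp add: square_integrable_def)
qed

definition shift :: "complex ^ 'n ^ 'n \<Rightarrow> complex \<Rightarrow> complex ^ 'n \<Rightarrow> complex ^ 'n" where
  "shift A l v = A *v v - l *s v"

lemma linear_matrix_vector_complex: "linear (\<lambda>v. A *v v)" for A :: "complex ^ 'n ^ 'm"
  by (intro linearI) (simp_all add: matrix_vector_mult_def vec_eq_iff scaleR_sum_right
      sum.distrib distrib_left)

lemma linear_shift: "linear (shift A l)"
  by (intro linearI)
     (simp_all add: shift_def linear_add[OF linear_matrix_vector_complex]
       linear_scale[OF linear_matrix_vector_complex] vec_eq_iff algebra_simps)

lemma matrix_vector_mult_shift: "A *v shift A l v = shift A l (A *v v)"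
  by (simp add: shift_def matrix_vector_mult_diff_distrib vector_scalar_commute)

lemma shift_commute: "shift A k (shift A l v) = shift A l (shift A k v)"
  by (simp add: shift_def[of A k] matrix_vector_mult_shift)
     (simp add: shift_def matrix_vector_mult_diff_distrib vector_scalar_commute vec_eq_iff algebra_simps)

lemma fold_shift_commute: "fold (shift A) ls (shift A l v) = shift A l (fold (shift A) ls v)"
proof (induction ls arbitrary: v)
  case (Cons k ls)
  then show ?case by (simp add: shift_commute[of A k l])
qed simp

lemma inner_scale_complex: "v \<bullet> (l *s v) = Re l * (norm v)\<^sup>2" for v :: "complex ^ 'n"
  unfolding power2_norm_eq_inner
  by (simp add: inner_vec_def inner_complex_def sum_distrib_left algebra_simps)

text \<open>Applying \<open>A - l\<close> to the state gives a state of the same system, with input \<open>(A - l) f\<close>, that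
  is annihilated by the shorter product. The scalar equation \<open>y' = l y + (y1 + f)\<close> then recovers
  \<open>y\<close> from \<open>y1 = (A - l) y\<close>.\<close>

lemma square_integrable_if_annihilated:
  fixes y f :: "real \<Rightarrow> complex ^ 'n"
  assumes "ac_deriv y (\<lambda>t. A *v y t + f t)" "square_integrable f"
    and "\<And>l. l \<in> set ls \<Longrightarrow> Re l < 0" "\<And>t. 0 \<le> t \<Longrightarrow> fold (shift A) ls (y t) = 0"
  shows "square_integrable y"
  using assms
proof (induction ls arbitrary: y f)
  case Nil
  have "y \<in> borel_measurable (lebesgue_on {0..})"
    using ac_deriv_continuous_halfline[OF Nil.prems(1)]
    by (intro continuous_imp_measurable_on_sets_lebesgue) auto
  then show ?case
    using Nil.prems(4) by (intro square_integrable_bound[where g = "\<lambda>_. 0"])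
      (auto intro: has_integral_integrable[OF has_integral_0])
next
  case (Cons l ls)
  define y1 where "y1 t = shift A l (y t)" for t
  have "ac_deriv y1 (\<lambda>t. shift A l (A *v y t + f t))"
    unfolding y1_def using Cons.prems(1) linear_shift by (rule ac_deriv_linear)
  then have "ac_deriv y1 (\<lambda>t. A *v y1 t + shift A l (f t))"
    by (simp add: linear_add[OF linear_shift] y1_def matrix_vector_mult_shift)
  then have y1: "square_integrable y1"
    by (rule Cons.IH) (use Cons.prems square_integrable_linear[OF _ linear_shift] in \<open>auto simp: y1_def\<close>)
  show ?case
  proof (rule dissipative_imp_square_integrable)
    show "ac_deriv y (\<lambda>t. l *s y t + (y1 t + f t))"
      using Cons.prems(1) by (simp add: y1_def shift_def algebra_simps)
    show "square_integrable (\<lambda>t. y1 t + f t)" using y1 Cons.prems(2) by (rule square_integrable_add)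
    show "0 < - Re l" using Cons.prems(3) by simp
    show "v \<bullet> (l *s v) \<le> - (- Re l) * (norm v)\<^sup>2" for v by (simp add: inner_scale_complex)
  qed
qed

text \<open>The vector \<open>p(A) v\<close>, by Horner's rule.\<close>

definition poly_apply :: "complex ^ 'n ^ 'n \<Rightarrow> complex poly \<Rightarrow> complex ^ 'n \<Rightarrow> complex ^ 'n" where
  "poly_apply A p v = fold_coeffs (\<lambda>a u. a *s v + A *v u) p 0"

lemma poly_apply_0 [simp]: "poly_apply A 0 v = 0"
  by (simp add: poly_apply_def)

lemma poly_apply_pCons [simp]: "poly_apply A (pCons a p) v = a *s v + A *v poly_apply A p v"
  by (cases "a = 0 \<and> p = 0") (auto simp: poly_apply_def)

lemma poly_apply_add: "poly_apply A (p + q) v = poly_apply A p v + poly_apply A q v"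
  by (induction p q rule: poly_induct2)
     (simp_all add: matrix_vector_right_distrib vector_sadd_rdistrib algebra_simps)

lemma poly_apply_smult: "poly_apply A (smult c p) v = c *s poly_apply A p v"
  by (induction p) (simp_all add: vector_scalar_commute vector_add_ldistrib vector_smult_assoc)

lemma poly_apply_monom: "poly_apply A (monom c i) v = c *s (((*v) A ^^ i) v)"
  by (induction i) (simp_all add: monom_0 monom_Suc vector_scalar_commute)

lemma poly_apply_sum: "poly_apply A (sum f I) v = (\<Sum>i\<in>I. poly_apply A (f i) v)"
  by (induction I rule: infinite_finite_induct) (simp_all add: poly_apply_add)

lemma poly_apply_root_factor: "poly_apply A ([:- l, 1:] * p) v = shift A l (poly_apply A p v)"
proof -
  have "[:- l, 1:] * p = smult (- l) p + pCons 0 p" by simp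
  then show ?thesis
    by (simp only: poly_apply_add poly_apply_smult poly_apply_pCons shift_def) (simp add: vec_eq_iff)
qed

lemma poly_apply_roots:
  "poly_apply A (\<Prod>l\<leftarrow>ls. [:- l, 1:]) v = fold (shift A) ls v"
  by (induction ls arbitrary: v)
     (simp_all add: poly_apply_root_factor fold_shift_commute one_pCons del: mult_pCons_left)

text \<open>The powers of \<open>A\<close> up to the dimension of the matrix space are linearly dependent, or two of
  them coincide.\<close>

lemma annihilating_poly_exists:
  fixes A :: "complex ^ 'n ^ 'n"
  obtains p where "p \<noteq> 0" "\<And>v. poly_apply A p v = 0"
proof -
  define P where "P i = ((**) A ^^ i) (mat 1)" for i
  have P: "P i *v v = ((*v) A ^^ i) v" for i v
    by (induction i) (simp_all add: P_def flip: matrix_vector_mul_assoc)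
  define m where "m = DIM(complex ^ 'n ^ 'n)"
  obtain c :: "nat \<Rightarrow> real" where c: "\<exists>i\<le>m. c i \<noteq> 0" "(\<Sum>i\<le>m. c i *\<^sub>R P i) = 0"
  proof (cases "inj_on P {..m}")
    case True
    then have "card (P ` {..m}) > DIM(complex ^ 'n ^ 'n)" by (simp add: card_image m_def)
    then have "dependent (P ` {..m})" using independent_bound by fastforce
    then obtain u where "\<exists>v\<in>P ` {..m}. u v \<noteq> 0" "(\<Sum>v\<in>P ` {..m}. u v *\<^sub>R v) = 0"
      by (auto simp: dependent_finite)
    then show ?thesis using True by (intro that[of "u \<circ> P"]) (auto simp: sum.reindex)
  next
    case False
    then obtain i j where ij: "i \<le> m" "j \<le> m" "i \<noteq> j" "P i = P j" by (auto simp: inj_on_def)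
    define c where "c k = (if k = i then 1 else if k = j then - 1 else (0::real))" for k
    have "(\<Sum>k\<le>m. c k *\<^sub>R P k) = (\<Sum>k\<in>{i, j}. c k *\<^sub>R P k)"
      using ij by (intro sum.mono_neutral_right) (auto simp: c_def)
    also have "\<dots> = 0" using ij by (simp add: c_def)
    finally show ?thesis using ij by (intro that[of c]) (auto simp: c_def)
  qed
  define p where "p = (\<Sum>i\<le>m. monom (complex_of_real (c i)) i)"
  have "coeff p i = complex_of_real (c i)" if "i \<le> m" for i
    using that by (simp add: p_def coeff_sum)
  then have "p \<noteq> 0" using c(1) by (metis coeff_0 of_real_eq_0_iff)
  moreover have "poly_apply A p v = 0" for v
  proof -
    have "poly_apply A p v = (\<Sum>i\<le>m. complex_of_real (c i) *s (P i *v v))"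
      by (simp add: p_def poly_apply_sum poly_apply_monom P)
    also have "\<dots> = (\<Sum>i\<le>m. (c i *\<^sub>R P i) *v v)"
      by (intro sum.cong) (simp_all add: vec_eq_iff matrix_vector_mult_def scaleR_conv_of_real[where 'a = complex] sum_distrib_left mult.assoc)
    also have "\<dots> = (\<Sum>i\<le>m. c i *\<^sub>R P i) *v v"
      by (induction m) (simp_all add: matrix_vector_mult_add_rdistrib)
    finally show ?thesis using c(2) by simp
  qed
  ultimately show ?thesis using that by blast
qed

text \<open>Split an annihilating polynomial into linear factors. A factor \<open>A - l\<close> for which \<open>l\<close> is not
  an eigenvalue is injective and commutes with the others, so it can be removed from the product.\<close>

lemma annihilating_eigenvalues_exist:
  fixes A :: "complex ^ 'n ^ 'n"
  obtains ls where "\<And>l. l \<in> set ls \<Longrightarrow> \<exists>v. v \<noteq> 0 \<and> A *v v = l *s v"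
    "\<And>v. fold (shift A) ls v = 0"
proof -
  define eig where "eig l \<longleftrightarrow> (\<exists>v. v \<noteq> 0 \<and> A *v v = l *s v)" for l
  obtain p where p: "p \<noteq> 0" "\<And>v. poly_apply A p v = 0" using annihilating_poly_exists[of A] by blast
  obtain M where "p = smult (lead_coeff p) (\<Prod>x\<in>#M. [:- x, 1:])"
    using alg_closed_imp_factorization[OF p(1)] by blast
  moreover obtain ls where "mset ls = M" using ex_mset by blast
  ultimately have "p = smult (lead_coeff p) (\<Prod>l\<leftarrow>ls. [:- l, 1:])"
    by (metis mset_map prod_mset_prod_list)
  then have "lead_coeff p *s fold (shift A) ls v = 0" for v
    using p(2)[of v] by (metis poly_apply_smult poly_apply_roots)
  then have ls: "fold (shift A) ls v = 0" for v using p(1) by simp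
  have filter: "fold (shift A) (filter eig ls) v = 0" if "fold (shift A) ls v = 0" for ls v
    using that
  proof (induction ls arbitrary: v)
    case (Cons l ls)
    then have IH: "fold (shift A) (filter eig ls) (shift A l v) = 0" by simp
    show ?case
    proof (cases "eig l")
      case False
      have "shift A l (fold (shift A) (filter eig ls) v) = 0" using IH by (simp add: fold_shift_commute)
      then have "A *v fold (shift A) (filter eig ls) v = l *s fold (shift A) (filter eig ls) v"
        by (simp add: shift_def)
      then have "fold (shift A) (filter eig ls) v = 0" using False unfolding eig_def by blast
      then show ?thesis using False by simp
    qed (use IH in simp)
  qed simp
  show ?thesis by (rule that[of "filter eig ls"]) (auto simp: eig_def filter[OF ls])
qed

proposition hurwitz_imp_square_integrable:
  fixes A :: "real ^ 'n ^ 'n"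
  assumes A: "hurwitz A" and x: "ac_deriv x (\<lambda>t. A *v x t + f t)" and f: "square_integrable f"
  shows "square_integrable x"
proof -
  \<comment> \<open>The eigenvalues may be complex, so the state is embedded into complex vectors.\<close>
  define emb :: "real ^ 'n \<Rightarrow> complex ^ 'n" where "emb v = (\<chi> i. complex_of_real (v $ i))" for v
  define real_part :: "complex ^ 'n \<Rightarrow> real ^ 'n" where "real_part v = (\<chi> i. Re (v $ i))" for v
  let ?A = "map_matrix complex_of_real A"
  have lin: "linear emb" "linear real_part"
    by (auto intro!: linearI simp: emb_def real_part_def vec_eq_iff scaleR_conv_of_real[where 'a = complex])
  have emb: "emb (A *v v) = ?A *v emb v" for v
    by (simp add: emb_def matrix_vector_mult_def map_matrix_def vec_eq_iff)
  obtain ls where ls: "\<And>l. l \<in> set ls \<Longrightarrow> \<exists>v. v \<noteq> 0 \<and> ?A *v v = l *s v"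
    "\<And>v. fold (shift ?A) ls v = 0" using annihilating_eigenvalues_exist[of ?A] by blast
  have "square_integrable (\<lambda>t. emb (x t))"
  proof (rule square_integrable_if_annihilated[where ls = ls])
    show "ac_deriv (\<lambda>t. emb (x t)) (\<lambda>t. ?A *v emb (x t) + emb (f t))"
      using ac_deriv_linear[OF x lin(1)] by (simp add: linear_add[OF lin(1)] emb)
    show "square_integrable (\<lambda>t. emb (f t))" using f lin(1) by (rule square_integrable_linear)
    show "Re l < 0" if "l \<in> set ls" for l
      using A ls(1)[OF that] by (auto simp: hurwitz_def complex_eigenvalue_def)
  qed (rule ls(2))
  from square_integrable_linear[OF this lin(2)] show ?thesis
    by (simp add: real_part_def emb_def)
qed

section \<open>Nonnegative states of positive systems\<close>

text \<open>The Picard series for \<open>x' = N x + f\<close> with \<open>x 0 = 0\<close>. With the matrix outside the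
  integral, each partial sum is the first term plus \<open>N\<close> applied to the integral of the preceding
  partial sum, and only this integral has to be passed to the limit.\<close>

primrec picard_term ::
  "real ^ 'n ^ 'n \<Rightarrow> (real \<Rightarrow> real ^ 'n) \<Rightarrow> nat \<Rightarrow> real \<Rightarrow> real ^ 'n" where
  "picard_term N f 0 t = integral {0..t} f"
| "picard_term N f (Suc k) t = N *v integral {0..t} (picard_term N f k)"

lemma picard_term_continuous:
  assumes "\<And>T. f absolutely_integrable_on {0..T}"
  shows "continuous_on {0..T} (picard_term N f k)"
proof (induction k)
  case 0
  have "continuous_on {0..T} (\<lambda>t. integral {0..t} f)"
    using assms by (intro indefinite_integral_continuous_1) (auto simp: set_lebesgue_integral_eq_integral)
  then show ?case by (simp add: picard_term.simps(1)[abs_def])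
next
  case (Suc k)
  have "continuous_on {0..T} (\<lambda>t. N *v integral {0..t} (picard_term N f k))"
    using Suc.IH
    by (intro bounded_linear.continuous_on[OF matrix_vector_mul_bounded_linear]
        indefinite_integral_continuous_1 integrable_continuous_real)
  then show ?case by (simp add: picard_term.simps(2)[abs_def])
qed

lemma integral_nonneg_vec:
  fixes f :: "real \<Rightarrow> real ^ 'n"
  assumes "f integrable_on S" "\<And>s. s \<in> S \<Longrightarrow> 0 \<le> f s $ i"
  shows "0 \<le> integral S f $ i"
  using assms integrable_component[OF assms(1)]
  by (metis integral_component_eq_cart integral_nonneg integrable_linear[OF assms(1) bounded_linear_vec_nth, unfolded o_def])

lemma nonneg_matrix_vector_mult:
  fixes N :: "real ^ 'm ^ 'n"
  assumes "nonneg_matrix N" "\<And>i. 0 \<le> v $ i"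
  shows "0 \<le> (N *v v) $ i"
  using assms by (auto simp: matrix_vector_mult_def nonneg_matrix_def intro!: sum_nonneg)

lemma picard_term_nonneg:
  assumes f: "\<And>T. f absolutely_integrable_on {0..T}" and f_nonneg: "\<And>t i. 0 \<le> t \<Longrightarrow> 0 \<le> f t $ i"
    and N: "nonneg_matrix N" and t: "0 \<le> t"
  shows "0 \<le> picard_term N f k t $ i"
  using t
proof (induction k arbitrary: t i)
  case 0
  have "f integrable_on {0..t}" using f set_lebesgue_integral_eq_integral(1) by blast
  with f_nonneg show ?case by (auto intro: integral_nonneg_vec)
next
  case (Suc k)
  then show ?case
    using integrable_continuous_real[OF picard_term_continuous[OF f]]
    by (auto intro!: nonneg_matrix_vector_mult[OF N] integral_nonneg_vec)
qed

text \<open>On \<open>[0,T]\<close> the terms are dominated by \<open>M (K T)\<^sup>k / k!\<close>, where \<open>M\<close> bounds the first term and \<open>K\<close> the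
  operator norm of \<open>N\<close>.\<close>

lemma picard_term_bound:
  assumes f: "\<And>T. f absolutely_integrable_on {0..T}"
  obtains b where "summable b"
    "\<And>k t. 0 \<le> t \<Longrightarrow> t \<le> T \<Longrightarrow> norm (picard_term N f k t) \<le> b k"
proof -
  obtain K where K: "K > 0" "\<And>v. norm (N *v v) \<le> norm v * K"
    using bounded_linear.pos_bounded[OF matrix_vector_mul_bounded_linear[of N]] by blast
  have "bounded (picard_term N f 0 ` {0..T})"
    by (intro compact_imp_bounded compact_continuous_image picard_term_continuous[OF f]) auto
  then obtain M where M: "M > 0" "\<And>t. 0 \<le> t \<Longrightarrow> t \<le> T \<Longrightarrow> norm (picard_term N f 0 t) \<le> M"
    unfolding bounded_pos by auto
  have le: "norm (picard_term N f k t) \<le> M * ((K * t) ^ k / fact k)" if "0 \<le> t" "t \<le> T" for k t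
    using that
  proof (induction k arbitrary: t)
    case 0
    then show ?case using M(2) by simp
  next
    case (Suc k)
    \<comment> \<open>a primitive of the bound for the previous term\<close>
    define F where "F s = M * (K ^ k * s ^ Suc k / fact (Suc k))" for s :: real
    have "((\<lambda>s. M * ((K * s) ^ k / fact k)) has_integral F t - F 0) {0..t}"
    proof (rule fundamental_theorem_of_calculus)
      fix s assume "s \<in> {0..t}"
      have "(F has_real_derivative M * (K ^ k * (real (Suc k) * s ^ k) / fact (Suc k))) (at s within {0..t})"
        unfolding F_def by (rule derivative_eq_intros refl | simp)+
      also have "M * (K ^ k * (real (Suc k) * s ^ k) / fact (Suc k)) = M * ((K * s) ^ k / fact k)"
        by (simp add: field_simps power_mult_distrib del: of_nat_Suc)
      finally show "(F has_vector_derivative M * ((K * s) ^ k / fact k)) (at s within {0..t})"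
        by (simp add: has_real_derivative_iff_has_vector_derivative)
    qed (use Suc.prems in auto)
    then have int: "((\<lambda>s. M * ((K * s) ^ k / fact k)) has_integral F t) {0..t}" by (simp add: F_def)
    have "norm (picard_term N f (Suc k) t) \<le> norm (integral {0..t} (picard_term N f k)) * K"
      using K(2) by simp
    also have "norm (integral {0..t} (picard_term N f k)) \<le> integral {0..t} (\<lambda>s. M * ((K * s) ^ k / fact k))"
      using Suc.IH Suc.prems int integrable_continuous_real[OF picard_term_continuous[OF f]]
      by (intro Henstock_Kurzweil_Integration.integral_norm_bound_integral) auto
    also have "\<dots> * K = M * ((K * t) ^ Suc k / fact (Suc k))"
      using integral_unique[OF int] by (simp add: F_def power_mult_distrib)
    finally show ?case using K(1) by simp
  qed
  show ?thesis
  proof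
    show "summable (\<lambda>k. M * ((K * T) ^ k / fact k))"
      using summable_exp_generic[of "K * T"] by (intro summable_mult) (simp add: field_simps)
    fix k t assume t: "0 \<le> t" "t \<le> T"
    have "M * ((K * t) ^ k / fact k) \<le> M * ((K * T) ^ k / fact k)"
      using t M K by (intro mult_left_mono divide_right_mono power_mono) auto
    then show "norm (picard_term N f k t) \<le> M * ((K * T) ^ k / fact k)"
      using le[OF t, of k] by linarith
  qed
qed

text \<open>The sum of the Picard series: it solves the equation because the series converges uniformly on
  bounded intervals, and it is nonnegative because each of its terms is.\<close>

lemma nonneg_linear_ode_solution:
  fixes N :: "real ^ 'n ^ 'n"
  assumes f: "\<And>T. f absolutely_integrable_on {0..T}" and f_nonneg: "\<And>t i. 0 \<le> t \<Longrightarrow> 0 \<le> f t $ i"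
    and N: "nonneg_matrix N"
  obtains x where "x 0 = 0" "ac_deriv x (\<lambda>t. N *v x t + f t)" "\<And>t i. 0 \<le> t \<Longrightarrow> 0 \<le> x t $ i"
proof -
  define x where "x t = (\<Sum>k. picard_term N f k t)" for t
  note cont = picard_term_continuous[OF f]
  have unif: "uniform_limit {0..T} (\<lambda>n t. \<Sum>k<n. picard_term N f k t) x sequentially" for T
  proof -
    obtain b where "summable b" "\<And>k t. 0 \<le> t \<Longrightarrow> t \<le> T \<Longrightarrow> norm (picard_term N f k t) \<le> b k"
      using picard_term_bound[OF f] by blast
    then show ?thesis unfolding x_def by (intro Weierstrass_m_test) auto
  qed
  have sums: "(\<lambda>k. picard_term N f k t) sums x t" if "0 \<le> t" for t
    using tendsto_uniform_limitI[OF unif[of t], of t] that by (simp add: sums_def)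
  have f_int: "f integrable_on {0..T}" for T using f set_lebesgue_integral_eq_integral(1) by blast
  have x_eq: "((\<lambda>s. N *v x s + f s) has_integral x t) {0..t}" if t: "0 \<le> t" for t
  proof -
    obtain I J where I: "\<And>n. ((\<lambda>s. \<Sum>k<n. picard_term N f k s) has_integral I n) {0..t}"
      and J: "(x has_integral J) {0..t}" and lim: "I \<longlonglongrightarrow> J"
      by (rule uniform_limit_integral[OF unif[of t]]) (use cont in \<open>auto intro!: continuous_on_sum\<close>)
    have "N *v I n = (\<Sum>k<n. picard_term N f (Suc k) t)" for n
    proof -
      have "I n = (\<Sum>k<n. integral {0..t} (picard_term N f k))"
        using integral_unique[OF I[of n]] integrable_continuous_real[OF cont]
        by (subst (asm) integral_sum) auto
      then show ?thesis by (simp add: linear_sum[OF matrix_vector_mul_linear])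
    qed
    moreover have "(\<lambda>n. N *v I n) \<longlonglongrightarrow> N *v J"
      by (rule bounded_linear.tendsto[OF matrix_vector_mul_bounded_linear lim])
    ultimately have "(\<lambda>k. picard_term N f (Suc k) t) sums (N *v J)" by (simp add: sums_def)
    moreover have "(\<lambda>k. picard_term N f (Suc k) t) sums (x t - picard_term N f 0 t)"
      using sums_Suc_iff[of "\<lambda>k. picard_term N f k t"] sums[OF t] by simp
    ultimately have "N *v J = x t - integral {0..t} f" using sums_unique2 by fastforce
    moreover have "((\<lambda>s. N *v x s + f s) has_integral N *v J + integral {0..t} f) {0..t}"
      using has_integral_linear[OF J matrix_vector_mul_bounded_linear[of N]] integrable_integral[OF f_int]
      by (intro has_integral_add) (auto simp: o_def)
    ultimately show ?thesis by simp
  qed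
  show ?thesis
  proof
    show x0: "x 0 = 0" using integral_unique[OF x_eq[of 0]] by simp
    have "continuous_on {0..T} x" for T
      by (intro uniform_limit_theorem[OF _ unif] always_eventually allI continuous_on_sum cont) auto
    then have "(\<lambda>t. N *v x t) absolutely_integrable_on {0..T}" for T
      by (intro absolutely_integrable_continuous_real bounded_linear.continuous_on[OF matrix_vector_mul_bounded_linear])
    then have "(\<lambda>t. N *v x t + f t) absolutely_integrable_on {0..T}" for T
      using f by (intro set_integral_add) auto
    then show "ac_deriv x (\<lambda>t. N *v x t + f t)" using x_eq x0 by (simp add: ac_deriv_def)
    show "0 \<le> x t $ i" if "0 \<le> t" for t i
    proof -
      have lim: "(\<lambda>k. picard_term N f k t $ i) sums (x t $ i)"
        by (rule bounded_linear.sums[OF bounded_linear_vec_nth sums[OF that]])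
      have terms: "0 \<le> picard_term N f k t $ i" for k
        using f f_nonneg N that by (rule picard_term_nonneg)
      show ?thesis by (rule sums_le[OF terms sums_zero lim])
    qed
  qed
qed

lemma ac_deriv_exp:
  fixes c :: real
  shows "ac_deriv (\<lambda>t. exp (c * t)) (\<lambda>t. c * exp (c * t))"
  unfolding ac_deriv_def
proof (intro allI impI conjI)
  fix T :: real assume T: "0 \<le> T"
  show "(\<lambda>t. c * exp (c * t)) absolutely_integrable_on {0..T}"
    by (intro absolutely_integrable_continuous_real continuous_intros)
  show "((\<lambda>t. c * exp (c * t)) has_integral exp (c * T) - exp (c * 0)) {0..T}"
    using T by (intro fundamental_theorem_of_calculus)
      (auto intro!: derivative_eq_intros simp flip: has_real_derivative_iff_has_vector_derivative)
qed

text \<open>A Metzler matrix becomes entrywise nonnegative after adding a large multiple \<open>c\<close> of the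
  identity. Solving for \<open>y = exp (c t) x\<close> turns \<open>x' = A x + g\<close> into \<open>y' = (A + c I) y + exp (c t) g\<close>,
  whose coefficient matrix and input are nonnegative.\<close>

proposition metzler_positive_system:
  fixes A :: "real ^ 'n ^ 'n"
  assumes A: "metzler A" and g: "\<And>T. g absolutely_integrable_on {0..T}"
    and g_nonneg: "\<And>t i. 0 \<le> t \<Longrightarrow> 0 \<le> g t $ i"
  obtains x where "x 0 = 0" "ac_deriv x (\<lambda>t. A *v x t + g t)" "\<And>t i. 0 \<le> t \<Longrightarrow> 0 \<le> x t $ i"
proof -
  define c where "c = (\<Sum>i\<in>UNIV. \<bar>A $ i $ i\<bar>)"
  define N where "N = A + c *\<^sub>R mat 1"
  \<comment> \<open>Only the diagonal of a Metzler matrix can be negative, and \<open>c\<close> dominates it.\<close>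
  have "\<bar>A $ i $ i\<bar> \<le> c" for i unfolding c_def by (rule member_le_sum) auto
  then have "- A $ i $ i \<le> c" for i using abs_le_D2 by blast
  then have N: "nonneg_matrix N"
    using A by (auto simp: nonneg_matrix_def metzler_def N_def mat_def) (smt (verit))
  have N_mult: "N *v v = A *v v + c *\<^sub>R v" for v
    by (simp add: N_def matrix_vector_mult_add_rdistrib scaleR_matrix_vector_assoc[symmetric])
  define f where "f t = exp (c * t) *\<^sub>R g t" for t
  have f: "f absolutely_integrable_on {0..T}" for T
    unfolding f_def
    by (rule abs_integrable_continuous_product[OF bounded_bilinear_scaleR _ g]) (intro continuous_intros)
  have f_nonneg: "0 \<le> f t $ i" if "0 \<le> t" for t i using g_nonneg[OF that] by (simp add: f_def)
  obtain y where y: "y 0 = 0" "ac_deriv y (\<lambda>t. N *v y t + f t)" "\<And>t i. 0 \<le> t \<Longrightarrow> 0 \<le> y t $ i"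
    using nonneg_linear_ode_solution[OF f f_nonneg N] by blast
  define x where "x t = exp (- c * t) *\<^sub>R y t" for t
  show ?thesis
  proof
    show "x 0 = 0" using y(1) by (simp add: x_def)
    show "0 \<le> x t $ i" if "0 \<le> t" for t i using y(3)[OF that] by (simp add: x_def)
    have "ac_deriv x (\<lambda>t. (- c * exp (- c * t)) *\<^sub>R y t + exp (- c * t) *\<^sub>R (N *v y t + f t))"
      unfolding x_def by (rule ac_deriv_bilinear[OF bounded_bilinear_scaleR ac_deriv_exp y(2)])
    moreover have "(- c * exp (- c * t)) *\<^sub>R y t + exp (- c * t) *\<^sub>R (N *v y t + f t) = A *v x t + g t" for t
      by (simp add: x_def f_def N_mult matrix_vector_mult_scaleR scaleR_add_right mult.commute flip: exp_add)
    ultimately show "ac_deriv x (\<lambda>t. A *v x t + g t)" by simp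
  qed
qed

section \<open>Stacked vectors and the dissipation form\<close>

definition vjoin :: "'a ^ 'm \<Rightarrow> 'a ^ 'n \<Rightarrow> 'a ^ ('m::finite + 'n::finite)" where
  "vjoin x y = (\<chi> i. case i of Inl r \<Rightarrow> x $ r | Inr r \<Rightarrow> y $ r)"

lemma vjoin_nth [simp]: "vjoin x y $ Inl i = x $ i" "vjoin x y $ Inr j = y $ j"
  by (simp_all add: vjoin_def)

lemma vec_eq_iff_sum:
  fixes u v :: "'a ^ ('m::finite + 'n::finite)"
  shows "u = v \<longleftrightarrow> (\<forall>i. u $ Inl i = v $ Inl i) \<and> (\<forall>j. u $ Inr j = v $ Inr j)"
  by (auto simp: vec_eq_iff) (metis sum.exhaust)

lemma sum_UNIV_sum:
  fixes f :: "'m::finite + 'n::finite \<Rightarrow> 'a::comm_monoid_add"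
  shows "sum f UNIV = (\<Sum>i\<in>UNIV. f (Inl i)) + (\<Sum>j\<in>UNIV. f (Inr j))"
  using sum.Plus[of "UNIV :: 'm set" "UNIV :: 'n set" f] by (simp add: UNIV_Plus_UNIV)

lemma vjoin_cases:
  fixes u :: "'a ^ ('m::finite + 'n::finite)"
  obtains x y where "u = vjoin x y"
proof
  show "u = vjoin (\<chi> i. u $ Inl i) (\<chi> j. u $ Inr j)" by (simp add: vec_eq_iff_sum)
qed

lemma vjoin_add: "vjoin x y + vjoin x' y' = vjoin (x + x') (y + y')"
  by (simp add: vec_eq_iff_sum)

lemma inner_vjoin: "vjoin x y \<bullet> vjoin x' y' = x \<bullet> x' + y \<bullet> y'"
  by (simp add: inner_vec_def sum_UNIV_sum)

lemma linear_vjoin: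
  "linear (\<lambda>x :: real ^ 'm. vjoin x (0 :: real ^ 'n))"
  "linear (vjoin (0 :: real ^ 'm) :: real ^ 'n \<Rightarrow> _)"
  by (auto intro!: linearI simp: vec_eq_iff_sum)

lemma vjoin_decompose: "vjoin (x :: real ^ 'm) (y :: real ^ 'n) = vjoin x 0 + vjoin 0 y"
  by (simp add: vec_eq_iff_sum)

lemma ac_deriv_vjoin:
  assumes "ac_deriv x f" "ac_deriv y g"
  shows "ac_deriv (\<lambda>t. vjoin (x t :: real ^ 'm) (y t :: real ^ 'n)) (\<lambda>t. vjoin (f t) (g t))"
  using ac_deriv_add[OF ac_deriv_linear[OF assms(1) linear_vjoin(1)]
      ac_deriv_linear[OF assms(2) linear_vjoin(2)]]
  by (simp flip: vjoin_decompose)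

lemma square_integrable_vjoin:
  assumes "square_integrable x" "square_integrable y"
  shows "square_integrable (\<lambda>t. vjoin (x t :: real ^ 'm) (y t :: real ^ 'n))"
  using square_integrable_add[OF square_integrable_linear[OF assms(1) linear_vjoin(1)]
      square_integrable_linear[OF assms(2) linear_vjoin(2)]]
  by (simp flip: vjoin_decompose)

lemma vcat_mult: "vcat M N *v v = vjoin (M *v v) (N *v v)"
  by (simp add: vec_eq_iff_sum matrix_vector_mult_def vcat_def)

lemma hcat_mult: "hcat M N *v vjoin x y = M *v x + N *v y"
  by (simp add: vec_eq_iff matrix_vector_mult_def hcat_def sum_UNIV_sum)

lemma block_matrix_mult:
  "block_matrix M11 M12 M21 M22 *v vjoin x y = vjoin (M11 *v x + M12 *v y) (M21 *v x + M22 *v y)"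
  by (simp add: block_matrix_def vcat_mult hcat_mult)

lemma inner_transpose_left: "x \<bullet> (transpose A *v y) = (A *v x) \<bullet> y" for A :: "real ^ 'n ^ 'm"
  by (metis dot_lmul_matrix inner_commute transpose_matrix_vector)

lemma zero_id_mult:
  "(zero_id :: real ^ ('p::finite + 'w::finite) ^ (('n::finite + 'p) + 'w)) *v vjoin p w = vjoin (vjoin 0 p) w"
  by (simp add: zero_id_def block_matrix_mult vcat_mult)

lemma transpose_zero_id_mult:
  "transpose (zero_id :: real ^ ('p::finite + 'w::finite) ^ (('n::finite + 'p) + 'w)) *v vjoin (vjoin x p) w = vjoin p w"
proof -
  let ?Z = "zero_id :: real ^ ('p + 'w) ^ (('n + 'p) + 'w)"
  have "u \<bullet> (transpose ?Z *v vjoin (vjoin x p) w) = u \<bullet> vjoin p w" for u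
  proof -
    obtain a b where u: "u = vjoin a b" by (rule vjoin_cases)
    have "u \<bullet> (transpose ?Z *v vjoin (vjoin x p) w) = (?Z *v u) \<bullet> vjoin (vjoin x p) w"
      by (rule inner_transpose_left)
    also have "\<dots> = u \<bullet> vjoin p w"
      unfolding u zero_id_mult inner_vjoin by simp
    finally show ?thesis .
  qed
  then show ?thesis by (rule vector_eq_ldot[THEN iffD1, OF allI])
qed

lemma inner_symmetric_matrix:
  assumes "symmetric_matrix P"
  shows "u \<bullet> (P *v v) = v \<bullet> (P *v u)"
  using assms inner_transpose_left[of u P v] by (simp add: symmetric_matrix_def inner_commute)

text \<open>Along a trajectory, the first summand on the right is the derivative of \<open>x \<bullet> P x\<close>; the
  other two compare the power of the output with that of the input.\<close>

lemma dissipation_quadratic_form: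
  assumes P: "symmetric_matrix P"
  shows "vjoin x w \<bullet> (dissipation_matrix A B C D \<gamma> P *v vjoin x w) =
    2 * (x \<bullet> (P *v (A *v x + B *v w))) + (norm (C *v x + D *v w))\<^sup>2 - \<gamma>\<^sup>2 * (norm w)\<^sup>2"
proof -
  note sym = inner_symmetric_matrix[OF P]
  show ?thesis
    unfolding dissipation_matrix_def block_matrix_mult inner_vjoin power2_norm_eq_inner
      matrix_vector_mult_add_rdistrib matrix_vector_mult_diff_rdistrib inner_add_right inner_diff_right
      matrix_vector_mul_assoc[symmetric] inner_transpose_left matrix_vector_right_distrib inner_add_left
      scaleR_matrix_vector_assoc[symmetric] matrix_vector_mul_lid inner_scaleR_right
    using sym[of "A *v x" x] sym[of "B *v w" x]
    by (simp add: inner_commute)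
qed

section \<open>The gain bound\<close>

text \<open>Dissipation bounds \<open>V T + \<integral>|z|\<^sup>2\<close> by \<open>\<gamma>\<^sup>2 \<integral>|w|\<^sup>2\<close>, where \<open>V = x \<bullet> P x\<close> has no sign because \<open>P\<close> may
  be indefinite. As \<open>x\<close> is square integrable, every \<open>S\<close> has a later time \<open>T\<close> at which \<open>V T\<close> is
  arbitrarily close to zero, and the output energy up to \<open>S\<close> is at most the one up to \<open>T\<close>.\<close>

lemma dissipation_output_bound:
  assumes x: "ac_deriv x (\<lambda>t. A *v x t + B *v w t)" and x0: "x 0 = 0"
    and xL2: "square_integrable x" and w: "square_integrable w"
    and z: "square_integrable z" and z_eq: "\<And>t. 0 \<le> t \<Longrightarrow> z t = C *v x t + D *v w t"
    and P: "symmetric_matrix P"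
    and diss: "\<And>t. 0 \<le> t \<Longrightarrow> vjoin (x t) (w t) \<bullet> (dissipation_matrix A B C D \<gamma> P *v vjoin (x t) (w t)) \<le> 0"
  shows "integral {0..} (\<lambda>t. (norm (z t))\<^sup>2) \<le> \<gamma>\<^sup>2 * integral {0..} (\<lambda>t. (norm (w t))\<^sup>2)"
proof -
  define V where "V t = x t \<bullet> (P *v x t)" for t
  define V' where "V' t = 2 * (x t \<bullet> (P *v (A *v x t + B *v w t)))" for t
  note sym = inner_symmetric_matrix[OF P]
  have "ac_deriv V V'"
    using ac_deriv_bilinear[OF bounded_bilinear_inner x ac_deriv_linear[OF x matrix_vector_mul_linear[of P]]]
    unfolding V_def V'_def by (simp add: sym[of "A *v _ + _"])
  then have V': "(V' has_integral V T) {0..T}" if "0 \<le> T" for T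
    using that by (simp add: ac_deriv_def V_def x0)
  have V'_le: "V' t \<le> \<gamma>\<^sup>2 * (norm (w t))\<^sup>2 - (norm (z t))\<^sup>2" if "0 \<le> t" for t
    using diss[OF that] by (simp add: dissipation_quadratic_form[OF P] V'_def z_eq[OF that])
  define W where "W = integral {0..} (\<lambda>t. (norm (w t))\<^sup>2)"
  have energy: "V T + integral {0..T} (\<lambda>t. (norm (z t))\<^sup>2) \<le> \<gamma>\<^sup>2 * W" if T: "0 \<le> T" for T
  proof -
    note int = square_integrable_norm_square[OF w order_refl, of T] square_integrable_norm_square[OF z order_refl, of T]
    have "V T \<le> integral {0..T} (\<lambda>t. \<gamma>\<^sup>2 * (norm (w t))\<^sup>2 - (norm (z t))\<^sup>2)"
      unfolding integral_unique[OF V'[OF T], symmetric]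
      using V'[OF T] V'_le int
      by (intro integral_le integrable_diff integrable_on_mult_right) auto
    also have "\<dots> = \<gamma>\<^sup>2 * integral {0..T} (\<lambda>t. (norm (w t))\<^sup>2) - integral {0..T} (\<lambda>t. (norm (z t))\<^sup>2)"
      using int by (subst integral_diff) (auto intro!: integrable_on_mult_right)
    also have "\<dots> \<le> \<gamma>\<^sup>2 * W - integral {0..T} (\<lambda>t. (norm (z t))\<^sup>2)"
      unfolding W_def by (intro diff_right_mono mult_left_mono square_integrable_integral_le[OF w]) auto
    finally show ?thesis by simp
  qed
  obtain K where K: "K > 0" "\<And>v. norm (P *v v) \<le> norm v * K"
    using bounded_linear.pos_bounded[OF matrix_vector_mul_bounded_linear[of P]] by blast
  have V_ge: "- K * (norm (x t))\<^sup>2 \<le> V t" for t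
  proof -
    have "\<bar>V t\<bar> \<le> norm (x t) * norm (P *v x t)" unfolding V_def by (rule Cauchy_Schwarz_ineq2)
    also have "\<dots> \<le> norm (x t) * (norm (x t) * K)" by (intro mult_left_mono K(2)) auto
    finally show ?thesis by (simp add: power2_eq_square mult_ac)
  qed
  have "integral {0..S} (\<lambda>t. (norm (z t))\<^sup>2) \<le> \<gamma>\<^sup>2 * W" if S: "0 \<le> S" for S
  proof (rule field_le_epsilon)
    fix e :: real assume e: "e > 0"
    then have "e / K > 0" using K(1) by simp
    then obtain T where T: "T \<ge> S" "(norm (x T))\<^sup>2 < e / K"
      using square_integrable_frequently_small[OF xL2 _ S] by blast
    have "integral {0..S} (\<lambda>t. (norm (z t))\<^sup>2) \<le> integral {0..T} (\<lambda>t. (norm (z t))\<^sup>2)"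
      using T(1) square_integrable_norm_square[OF z order_refl] by (intro integral_subset_le) auto
    also have "\<dots> \<le> \<gamma>\<^sup>2 * W - V T" using energy[of T] S T(1) by simp
    also have "\<dots> \<le> \<gamma>\<^sup>2 * W + K * (norm (x T))\<^sup>2" using V_ge[of T] by simp
    also have "\<dots> \<le> \<gamma>\<^sup>2 * W + e" using T(2) K(1) by (simp add: field_simps)
    finally show "integral {0..S} (\<lambda>t. (norm (z t))\<^sup>2) \<le> \<gamma>\<^sup>2 * W + e" .
  qed
  then show ?thesis
    unfolding W_def using square_integrable_norm_square[OF z order_refl]
    by (intro nonneg_integrable_on_halfline(2)) auto
qed

theorem theorem1:
  fixes A :: "real ^ 'n ^ 'n" and B :: "real ^ 'w ^ 'n"
    and C :: "real ^ 'n ^ 'z" and D :: "real ^ 'w ^ 'z"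
    and Ap :: "real ^ 'p ^ 'p" and Bp :: "real ^ 'w ^ 'p"
    and \<gamma> :: real
  assumes "hurwitz A" and "controllable A B"
    and "hurwitz Ap" and "metzler Ap" and "nonneg_matrix Bp"
    and "\<gamma> > 0"
    and "\<exists>(Pa :: real ^ ('n + 'p) ^ ('n + 'p)) (Qa :: real ^ ('p + 'w) ^ ('p + 'w)).
           symmetric_matrix Pa \<and> Qa \<in> COP \<and>
           negative_semidefinite
             (dissipation_matrix (aug_A A Ap) (aug_B B Bp) (aug_C C) D \<gamma> Pa
              + zero_id ** Qa ** transpose zero_id)"
  shows "L2_plus_induced_norm A B C D \<le> ennreal \<gamma>"
proof -
  obtain Pa :: "real ^ ('n + 'p) ^ ('n + 'p)" and Qa :: "real ^ ('p + 'w) ^ ('p + 'w)"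
    where Pa: "symmetric_matrix Pa" and Qa: "Qa \<in> COP"
      and neg: "negative_semidefinite
        (dissipation_matrix (aug_A A Ap) (aug_B B Bp) (aug_C C) D \<gamma> Pa
         + zero_id ** Qa ** transpose zero_id)"
    using assms(7) by blast
  let ?M = "dissipation_matrix (aug_A A Ap) (aug_B B Bp) (aug_C C) D \<gamma> Pa"
  \<comment> \<open>The augmented system is dissipative wherever the copositive term is nonnegative.\<close>
  have diss: "vjoin (vjoin u p) v \<bullet> (?M *v vjoin (vjoin u p) v) \<le> 0"
    if "\<And>i. 0 \<le> p $ i" "\<And>i. 0 \<le> v $ i" for u p v
  proof -
    let ?y = "vjoin (vjoin u p) v"
    have "0 \<le> vjoin p v $ i" for i using that by (cases i) auto
    then have "0 \<le> vjoin p v \<bullet> (Qa *v vjoin p v)" using Qa by (auto simp: COP_def)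
    also have "\<dots> = ?y \<bullet> ((zero_id ** Qa ** transpose zero_id) *v ?y)"
      using inner_transpose_left[of ?y "transpose zero_id" "Qa *v vjoin p v"]
      by (simp add: transpose_zero_id_mult inner_commute del: transpose_matrix_vector flip: matrix_vector_mul_assoc)
    finally have "0 \<le> ?y \<bullet> ((zero_id ** Qa ** transpose zero_id) *v ?y)" .
    moreover have "?y \<bullet> ((?M + zero_id ** Qa ** transpose zero_id) *v ?y) \<le> 0"
      using neg unfolding negative_semidefinite_def by blast
    ultimately show ?thesis by (simp add: matrix_vector_mult_add_rdistrib inner_add_right)
  qed
  have "L2_norm z \<le> ennreal \<gamma>"
    if w: "w \<in> L2_plus" "L2_norm w = 1" and z: "system_output A B C D w z" for w z
  proof -
    have w_nonneg: "0 \<le> w t $ i" if "0 \<le> t" for t i using w(1) that by (simp add: L2_plus_def)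
    have wL2: "square_integrable w" using w(1) by (simp add: L2_plus_def L2_imp_square_integrable)
    note w_int = square_integrable_abs_integrable[OF wL2]
    have "sqrt (integral {0..} (\<lambda>t. (norm (w t))\<^sup>2)) = 1"
      using w(2) by (simp add: L2_norm_square_integrable[OF wL2])
    then have w_unit: "integral {0..} (\<lambda>t. (norm (w t))\<^sup>2) = 1" by simp
    obtain x where x0: "x 0 = 0" and traj: "state_trajectory A B w x"
      and z_eq: "\<And>t. 0 \<le> t \<Longrightarrow> z t = C *v x t + D *v w t"
      using z by (auto simp: system_output_def)
    have x: "ac_deriv x (\<lambda>t. A *v x t + B *v w t)"
      using traj w_int by (rule state_trajectory_imp_ac_deriv)
    have "(\<lambda>t. Bp *v w t) absolutely_integrable_on {0..T}" for T
      using absolutely_integrable_linear[OF w_int matrix_vector_mul_bounded_linear] by (simp add: o_def)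
    then obtain p where p0: "p 0 = 0" and p: "ac_deriv p (\<lambda>t. Ap *v p t + Bp *v w t)"
      and p_nonneg: "\<And>t i. 0 \<le> t \<Longrightarrow> 0 \<le> p t $ i"
      using metzler_positive_system[OF assms(4), of "\<lambda>t. Bp *v w t"]
        nonneg_matrix_vector_mult[OF assms(5) w_nonneg] by blast
    define xa where "xa t = vjoin (x t) (p t)" for t
    have xL2: "square_integrable x"
      using assms(1) x square_integrable_linear[OF wL2 matrix_vector_mul_linear] by (rule hurwitz_imp_square_integrable)
    have pL2: "square_integrable p"
      using assms(3) p square_integrable_linear[OF wL2 matrix_vector_mul_linear] by (rule hurwitz_imp_square_integrable)
    have zL2: "square_integrable z"
    proof (rule square_integrable_cong)
      show "square_integrable (\<lambda>t. C *v x t + D *v w t)"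
        by (intro square_integrable_add square_integrable_linear[OF _ matrix_vector_mul_linear] xL2 wL2)
    qed (simp add: z_eq)
    have "integral {0..} (\<lambda>t. (norm (z t))\<^sup>2) \<le> \<gamma>\<^sup>2 * integral {0..} (\<lambda>t. (norm (w t))\<^sup>2)"
    proof (rule dissipation_output_bound[OF _ _ _ wL2 zL2 _ Pa])
      show "ac_deriv xa (\<lambda>t. aug_A A Ap *v xa t + aug_B B Bp *v w t)"
        unfolding xa_def using ac_deriv_vjoin[OF x p]
        by (simp add: aug_A_def aug_B_def block_matrix_mult vcat_mult vjoin_add)
      show "xa 0 = 0" using x0 p0 by (simp add: xa_def vec_eq_iff_sum)
      show "square_integrable xa" unfolding xa_def using xL2 pL2 by (rule square_integrable_vjoin)
      show "z t = aug_C C *v xa t + D *v w t" if "0 \<le> t" for t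
        using z_eq[OF that] by (simp add: aug_C_def xa_def hcat_mult)
      show "vjoin (xa t) (w t) \<bullet> (?M *v vjoin (xa t) (w t)) \<le> 0" if "0 \<le> t" for t
        unfolding xa_def using p_nonneg[OF that] w_nonneg[OF that] by (rule diss)
    qed
    then have "sqrt (integral {0..} (\<lambda>t. (norm (z t))\<^sup>2)) \<le> \<gamma>"
      using assms(6) by (simp add: w_unit real_le_lsqrt)
    then show ?thesis by (simp add: L2_norm_square_integrable[OF zL2] ennreal_leI)
  qed
  then show ?thesis unfolding L2_plus_induced_norm_def by (intro Sup_least) blast
qed

end
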